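(* Let $\boldsymbol{b}=(b_k)_{k\in\mathbb{N}}$ be a strictly increasing sequence of real numbers with $b_0=0$, satisfying the following two conditions: (i) there exists a constant $c>0$ such that $1+b_{k-1}^2\geq c\,(b_k-b_{k-1})^2$ for all integers $k\geq 1$; (ii) $$G_{\boldsymbol{b}}:=\sup_{n\geq 1}\ \sup_{1\leq l\leq n}\left(\frac{b_{n+2l}-b_{n+l}}{b_{n+l}-b_n}+\frac{b_{n+l}-b_n}{b_{n+2l}-b_{n+l}}\right)<+\infty .$$ Then for any admissible sequence $\boldsymbol{\delta}$ of positive real numbers, the Lebesgue differentiation process associated to the sequence of rectangles $\boldsymbol{R}(\boldsymbol{b},\boldsymbol{\delta})=(R_k)_{k\geq 1}$ is $L^\infty$-bad.
   Context: Construction of the rectangles. Let $A:=(0,1)$ and $B_k:=(b_k,0)$ for $k\in\mathbb{N}=\{0,1,2,\dots\}$, and for $k\geq 1$ let $\Delta_k$ be the triangle $AB_{k-1}B_k$. Let $B_k'$ be the point defined by $\overrightarrow{AB_k'}=\frac32\overrightarrow{AB_k}$, so that the triangle $AB_{k-1}'B_k'$ is the image of $\Delta_k$ under the homothety centered at $A$ with ratio $\frac32$. For $k\geq 1$ let $\tilde P_k$ be the smallest rectangle having the segment $AB_k'$ as one of its sides and containing the triangle $AB_{k-1}'B_k'$, and let $P_k$ be the translate of $\tilde P_k$ centered at the origin. Given a sequence $\boldsymbol{\delta}=(\delta_n)$ of positive real numbers indexed by the integers $n\geq 0$, define $R_k:=\delta_nP_k$ (the dilate of $P_k$ by the factor $\delta_n$)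 for every integer $k\geq1$, where $n\geq 0$ is the integer with $2^n\leq k<2^{n+1}$. The sequence $\boldsymbol{\delta}$ is called admissible if $\operatorname{diam}R_k\to0$ as $k\to\infty$. The Lebesgue differentiation process associated to $(R_k)_{k\geq1}$ is the sequence of operators $T_kf(x):=\frac{1}{|R_k|}\int_{x+R_k}f$, where $|E|$ is the Lebesgue measure of $E$; its maximal operator is $T^*f(x):=\sup_{k\geq1}|T_kf(x)|$. The process is called $L^\infty$-good if for each $0<\lambda<1$ there exists a constant $C_\lambda>0$ such that for every Borel set $B\subseteq\mathbb{R}^2$ with finite Lebesgue measure, $|\{x\in\mathbb{R}^2: T^*\chi_B(x)>\lambda\}|\leq C_\lambda|B|$, where $\chi_B$ is the indicator function of $B$. It is called $L^\infty$-bad if it is not $L^\infty$-good. *)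

theory Defs
  imports "HOL-Analysis.Analysis"
begin

definition ptA :: "real \<times> real" where
  "ptA = (0, 1)"

definition ptB :: "(nat \<Rightarrow> real) \<Rightarrow> nat \<Rightarrow> real \<times> real" where
  "ptB b k = (b k, 0)"

definition ptB' :: "(nat \<Rightarrow> real) \<Rightarrow> nat \<Rightarrow> real \<times> real" where
  "ptB' b k = ptA + (3 / 2) *\<^sub>R (ptB b k - ptA)"

text \<open>Rectangles are closed and nondegenerate; \<open>v\<close> is the side vector orthogonal to the given side.\<close>

definition rectangle_with_side :: "real \<times> real \<Rightarrow> real \<times> real \<Rightarrow> (real \<times> real) set \<Rightarrow> bool" where
  "rectangle_with_side p q R \<longleftrightarrow>
     p \<noteq> q \<and> (\<exists>v. v \<noteq> 0 \<and> v \<bullet> (q - p) = 0 \<and> R = convex hull {p, q, q + v, p + v})"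

text \<open>For sets, \<open>LEAST\<close> refers to inclusion. The rectangles below are meant for \<open>k \<ge> 1\<close>;
  at \<open>k = 0\<close> they carry no meaning.\<close>

definition tilde_P :: "(nat \<Rightarrow> real) \<Rightarrow> nat \<Rightarrow> (real \<times> real) set" where
  "tilde_P b k = (LEAST R. rectangle_with_side ptA (ptB' b k) R \<and>
                           convex hull {ptA, ptB' b (k - 1), ptB' b k} \<subseteq> R)"

text \<open>A bounded set has at most one translate that is symmetric about the origin.\<close>

definition centered_translate :: "(real \<times> real) set \<Rightarrow> (real \<times> real) set" where
  "centered_translate S = (THE Q. (\<exists>v. Q = (+) v ` S) \<and> uminus ` Q = Q)"

definition rect_P :: "(nat \<Rightarrow> real) \<Rightarrow> nat \<Rightarrow> (real \<times> real) set" where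
  "rect_P b k = centered_translate (tilde_P b k)"

definition dyadic_index :: "nat \<Rightarrow> nat" where
  "dyadic_index k = (THE n. 2 ^ n \<le> k \<and> k < 2 ^ (n + 1))"

definition rect_R :: "(nat \<Rightarrow> real) \<Rightarrow> (nat \<Rightarrow> real) \<Rightarrow> nat \<Rightarrow> (real \<times> real) set" where
  "rect_R b \<delta> k = (\<lambda>x. \<delta> (dyadic_index k) *\<^sub>R x) ` rect_P b k"

definition admissible :: "(nat \<Rightarrow> real) \<Rightarrow> (nat \<Rightarrow> real) \<Rightarrow> bool" where
  "admissible b \<delta> \<longleftrightarrow> (\<lambda>k. diameter (rect_R b \<delta> k)) \<longlonglongrightarrow> 0"

definition avg_op ::
  "(nat \<Rightarrow> (real \<times> real) set) \<Rightarrow> nat \<Rightarrow> (real \<times> real \<Rightarrow> real) \<Rightarrow> real \<times> real \<Rightarrow> real" where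
  "avg_op R k f x =
     (1 / measure lborel (R k)) * set_lebesgue_integral lborel ((+) x ` R k) f"

definition maximal_op ::
  "(nat \<Rightarrow> (real \<times> real) set) \<Rightarrow> (real \<times> real \<Rightarrow> real) \<Rightarrow> real \<times> real \<Rightarrow> ereal" where
  "maximal_op R f x = (SUP k\<in>{1..}. ereal \<bar>avg_op R k f x\<bar>)"

definition Linfty_good :: "(nat \<Rightarrow> (real \<times> real) set) \<Rightarrow> bool" where
  "Linfty_good R \<longleftrightarrow>
     (\<forall>l::real. 0 < l \<and> l < 1 \<longrightarrow>
       (\<exists>C::real. C > 0 \<and>
         (\<forall>B \<in> sets borel. emeasure lborel B < \<infinity> \<longrightarrow>
            emeasure lborel {x. maximal_op R (indicator B) x > ereal l}
              \<le> ennreal C * emeasure lborel B)))"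

definition Linfty_bad :: "(nat \<Rightarrow> (real \<times> real) set) \<Rightarrow> bool" where
  "Linfty_bad R \<longleftrightarrow> \<not> Linfty_good R"

definition G_const :: "(nat \<Rightarrow> real) \<Rightarrow> ereal" where
  "G_const b = (SUP n\<in>{1..}. SUP l\<in>{1..n}.
     ereal ((b (n + 2 * l) - b (n + l)) / (b (n + l) - b n)
          + (b (n + l) - b n) / (b (n + 2 * l) - b (n + l))))"

end

theory Submission
  imports Defs
begin

text \<open>All rectangles with index in one dyadic block \<open>2 ^ n \<le> k < 2 ^ (n + 1)\<close> carry the same
  dilation factor \<open>h = \<delta> n\<close>, so a single block can be played against the weak-type inequality.
  Place \<open>A\<close> at the origin and let the \<open>k\<close>-th triangle be the cone of directions between
  \<open>(b (k - 1), -1)\<close> and \<open>(b k, -1)\<close>, cut off at depth \<open>h\<close>.  Translate it horizontally by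
  \<open>s\<^sub>k\<close>, let \<open>B\<close> be the union of the translates, and let \<open>V\<close> be the union of pieces of the
  opposite cones, which rise above the apices.  The weak-type inequality fails because of three facts.

  \<^item> \<open>B\<close> is small.  The shifts are chosen by repeated halving of the block:
    when a group of \<open>2 ^ (r + 1)\<close> consecutive triangles is split in two, the right half is moved to
    the left until, at depth \<open>t = (r + 1) h / n\<close>, its cone starts where the cone of the left half does.
    For \<open>t\<close> between \<open>r h / n\<close> and \<open>(r + 1) h / n\<close> every group of \<open>2 ^ r\<close> triangles
    is therefore almost concentrated: the splits at the levels below \<open>r\<close> are all nearly undone at
    depth \<open>t\<close>, the one at level \<open>r - i\<close> up to a factor of order \<open>i h / n\<close>, and since the halves of a
    group are comparable these errors form a convergent series (\<open>tree_slice_subset\<close>).  The slice of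
    \<open>B\<close> at each depth thus has length \<open>O(h D / n)\<close>, where \<open>D\<close> is the sum of the increments
    \<open>b k - b (k - 1)\<close> of the block, and \<open>B\<close> has area \<open>O(h\<^sup>2 D / n)\<close>
    (\<open>emeasure_perron_tree_le\<close>).  Comparability of the halves is exactly what finiteness of
    \<open>G_const b\<close> provides.

  \<^item> \<open>V\<close> is large.  The shifts decrease with \<open>k\<close> (\<open>perron_shift_antimono\<close>), while above the
    apices the cones open in the reverse order, so the pieces of \<open>V\<close> are disjoint and their total
    area is at least \<open>h\<^sup>2 D / 64\<close> (\<open>emeasure_arms_ge\<close>).

  \<^item> From each point of \<open>V\<close> one sees \<open>B\<close>.  The rectangle centred at a point of the \<open>k\<close>-th piece
    contains the upper half of the \<open>k\<close>-th triangle, which fills at least \<open>1 / 72\<close> of it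
    (\<open>avg_op_ge_on_arm\<close>).

  At level \<open>1 / 80\<close> the weak-type constant would thus be at least a fixed multiple of \<open>n\<close>, for every
  \<open>n \<ge> 1\<close>.\<close>

section \<open>Shifts producing a Perron tree\<close>

text \<open>The shift of triangle \<open>k\<close> inside the group \<open>{m<..m + 2 ^ r}\<close>.  At depth
  \<open>t = real (Suc r) * \<eta>\<close> the cones of the two halves start at \<open>t * b m\<close> and
  \<open>t * b (m + 2 ^ r)\<close>; the amount subtracted in the right half is the difference.\<close>

primrec perron_shift :: "(nat \<Rightarrow> real) \<Rightarrow> real \<Rightarrow> nat \<Rightarrow> nat \<Rightarrow> nat \<Rightarrow> real" where
  "perron_shift b \<eta> 0 m k = 0"
| "perron_shift b \<eta> (Suc r) m k =
     (if k \<le> m + 2 ^ r then perron_shift b \<eta> r m k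
      else perron_shift b \<eta> r (m + 2 ^ r) k - real (Suc r) * \<eta> * (b (m + 2 ^ r) - b m))"

text \<open>The horizontal slice, at depth \<open>t\<close> below the apices, of the union of the shifted triangles.\<close>

definition tree_slice :: "(nat \<Rightarrow> real) \<Rightarrow> real \<Rightarrow> nat \<Rightarrow> nat \<Rightarrow> real \<Rightarrow> real set" where
  "tree_slice b \<eta> r m t = (\<Union>k\<in>{m<..m + 2 ^ r}.
     {perron_shift b \<eta> r m k + t * b (k - 1) .. perron_shift b \<eta> r m k + t * b k})"

lemma tree_slice_0: "tree_slice b \<eta> 0 m t = {t * b m .. t * b (Suc m)}"
proof -
  have "{m<..m + 2 ^ 0} = {Suc m}" by auto
  then show ?thesis by (simp add: tree_slice_def)
qed

lemma tree_slice_Suc: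
  "tree_slice b \<eta> (Suc r) m t = tree_slice b \<eta> r m t \<union>
     (+) (- (real (Suc r) * \<eta> * (b (m + 2 ^ r) - b m))) ` tree_slice b \<eta> r (m + 2 ^ r) t"
proof -
  have "{m<..m + 2 ^ Suc r} = {m<..m + 2 ^ r} \<union> {m + 2 ^ r<..m + 2 ^ r + 2 ^ r}" by auto
  then have "tree_slice b \<eta> (Suc r) m t =
     (\<Union>k\<in>{m<..m + 2 ^ r}. {perron_shift b \<eta> (Suc r) m k + t * b (k - 1) .. perron_shift b \<eta> (Suc r) m k + t * b k})
     \<union> (\<Union>k\<in>{m + 2 ^ r<..m + 2 ^ r + 2 ^ r}. {perron_shift b \<eta> (Suc r) m k + t * b (k - 1) .. perron_shift b \<eta> (Suc r) m k + t * b k})"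
    by (simp only: tree_slice_def UN_Un)
  also have "\<dots> = tree_slice b \<eta> r m t \<union>
     (+) (- (real (Suc r) * \<eta> * (b (m + 2 ^ r) - b m))) ` tree_slice b \<eta> r (m + 2 ^ r) t"
    unfolding tree_slice_def image_UN
    by (intro arg_cong2[where f = "(\<union>)"] SUP_cong refl)
       (simp_all only: image_add_atLeastAtMost, simp_all)
  finally show ?thesis .
qed

lemma emeasure_lborel_plus:
  fixes A :: "'a::euclidean_space set"
  assumes "A \<in> sets borel"
  shows "emeasure lborel ((+) c ` A) = emeasure lborel A"
proof -
  have eq: "(+) c ` A = (+) (- c) -` A"
  proof (intro equalityI subsetI)
    fix x assume "x \<in> (+) (- c) -` A"
    then have "- c + x \<in> A" by simp
    then show "x \<in> (+) c ` A" by (rule rev_image_eqI) simp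
  qed auto
  have "emeasure lborel A = emeasure (distr lborel borel ((+) (- c))) A"
    by (simp add: lborel_distr_plus)
  also have "\<dots> = emeasure lborel ((+) (- c) -` A)"
    using assms by (subst emeasure_distr) auto
  finally show ?thesis by (simp add: eq)
qed

lemma borel_tree_slice [measurable, simp]: "tree_slice b \<eta> r m t \<in> sets borel"
  by (auto simp: tree_slice_def)

text \<open>At depths \<open>t \<ge> real r * \<eta>\<close> no right half is moved past the start of its left half, so the slice
  starts at \<open>t * b m\<close>.  The surplus \<open>K * \<eta>\<close> reproduces itself in the induction: passing from level
  \<open>r\<close> to level \<open>Suc r\<close> costs one more \<open>\<eta>\<close> on a single half, and this is at most
  \<open>K * \<eta>\<close> times the other half by the comparability \<open>bal\<close>.\<close>

lemma tree_slice_subset: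
  fixes b :: "nat \<Rightarrow> real"
  assumes b: "strict_mono b" and \<eta>: "\<eta> > 0" and K: "K > 0"
    and bal: "\<And>m l. M \<le> m \<Longrightarrow> 1 \<le> l \<Longrightarrow> l \<le> M \<Longrightarrow>
        b (m + 2 * l) - b (m + l) \<le> K * (b (m + l) - b m) \<and>
        b (m + l) - b m \<le> K * (b (m + 2 * l) - b (m + l))"
  shows "M \<le> m \<Longrightarrow> 2 ^ r \<le> 2 * M \<Longrightarrow> real r * \<eta> \<le> t \<Longrightarrow>
    tree_slice b \<eta> r m t \<subseteq>
      {t * b m .. t * b m + (t - real r * \<eta> + K * \<eta>) * (b (m + 2 ^ r) - b m)}"
proof (induction r arbitrary: m)
  case 0
  have "b m < b (Suc m)" using b by (simp add: strict_mono_Suc_iff)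
  then have "0 \<le> K * \<eta> * (b (Suc m) - b m)" using \<eta> K by simp
  then show ?case by (auto simp: tree_slice_0 algebra_simps)
next
  case (Suc r)
  define DL where "DL = b (m + 2 ^ r) - b m"
  define DR where "DR = b (m + 2 ^ r + 2 ^ r) - b (m + 2 ^ r)"
  define s where "s = t - real (Suc r) * \<eta>"
  have pos: "0 < DL" "0 < DR" using b by (simp_all add: DL_def DR_def strict_mono_less)
  have s: "0 \<le> s" using Suc.prems by (simp add: s_def)
  have t: "t - real r * \<eta> = s + \<eta>" by (simp add: s_def algebra_simps)
  have rt: "real r * \<eta> \<le> t" using t s \<eta> by linarith
  have le: "(2::nat) ^ r \<le> 2 * M" "(2::nat) ^ r \<le> M" "M \<le> m + 2 ^ r" using Suc.prems by simp_all
  have D: "b (m + 2 ^ Suc r) - b m = DL + DR" by (simp add: DL_def DR_def mult_2 add.assoc)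
  have balLR: "DR \<le> K * DL" "DL \<le> K * DR"
    using bal[of m "2 ^ r"] le Suc.prems(1) by (simp_all add: DL_def DR_def mult_2 add.assoc)
  have e: "\<eta> * DR \<le> \<eta> * (K * DL)" "\<eta> * DL \<le> \<eta> * (K * DR)" "0 \<le> s * DL" "0 \<le> s * DR"
    using balLR \<eta> s pos by simp_all
  have "tree_slice b \<eta> r m t \<subseteq> {t * b m .. t * b m + (s + \<eta> + K * \<eta>) * DL}"
    using Suc.IH[OF Suc.prems(1) le(1) rt] by (simp add: t DL_def)
  also have "\<dots> \<subseteq> {t * b m .. t * b m + (s + K * \<eta>) * (DL + DR)}"
    using e by (auto simp: algebra_simps)
  finally have L: "tree_slice b \<eta> r m t \<subseteq> {t * b m .. t * b m + (s + K * \<eta>) * (DL + DR)}" .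
  have "tree_slice b \<eta> r (m + 2 ^ r) t
      \<subseteq> {t * b (m + 2 ^ r) .. t * b (m + 2 ^ r) + (s + \<eta> + K * \<eta>) * DR}"
    using Suc.IH[OF le(3) le(1) rt] by (simp add: t DR_def)
  moreover have "t * b (m + 2 ^ r) = t * b m + s * DL + real (Suc r) * \<eta> * DL"
    by (simp add: DL_def s_def algebra_simps)
  ultimately have "(+) (- (real (Suc r) * \<eta> * DL)) ` tree_slice b \<eta> r (m + 2 ^ r) t
      \<subseteq> {t * b m + s * DL .. t * b m + s * DL + (s + \<eta> + K * \<eta>) * DR}"
    by (auto simp del: of_nat_Suc)
  also have "\<dots> \<subseteq> {t * b m .. t * b m + (s + K * \<eta>) * (DL + DR)}"
    using e by (auto simp: algebra_simps)
  finally show ?case using L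
    unfolding tree_slice_Suc D s_def[symmetric] DL_def[symmetric] by simp
qed

text \<open>At level \<open>r0\<close> the previous inclusion bounds the slice of each group by a short interval.  At the
  levels above, the groups are merely moved about, and subadditivity is enough.\<close>

lemma emeasure_tree_slice_le:
  fixes b :: "nat \<Rightarrow> real"
  assumes b: "strict_mono b" and \<eta>: "\<eta> > 0" and K: "K > 0"
    and bal: "\<And>m l. M \<le> m \<Longrightarrow> 1 \<le> l \<Longrightarrow> l \<le> M \<Longrightarrow>
        b (m + 2 * l) - b (m + l) \<le> K * (b (m + l) - b m) \<and>
        b (m + l) - b m \<le> K * (b (m + 2 * l) - b (m + l))"
    and t: "real r0 * \<eta> \<le> t" "t \<le> real (Suc r0) * \<eta>"
  shows "M \<le> m \<Longrightarrow> 2 ^ (r0 + j) \<le> 2 * M \<Longrightarrow>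
    emeasure lborel (tree_slice b \<eta> (r0 + j) m t) \<le> ennreal ((1 + K) * \<eta> * (b (m + 2 ^ (r0 + j)) - b m))"
proof (induction j arbitrary: m)
  case 0
  have pos: "0 < b (m + 2 ^ r0) - b m" using b by (simp add: strict_mono_less)
  have "emeasure lborel (tree_slice b \<eta> r0 m t) \<le>
      emeasure lborel {t * b m .. t * b m + (t - real r0 * \<eta> + K * \<eta>) * (b (m + 2 ^ r0) - b m)}"
    using 0 tree_slice_subset[OF b \<eta> K bal _ _ t(1), of M] by (intro emeasure_mono) auto
  also have "\<dots> = ennreal ((t - real r0 * \<eta> + K * \<eta>) * (b (m + 2 ^ r0) - b m))"
    using pos t K \<eta> by (subst emeasure_lborel_Icc) auto
  also have "\<dots> \<le> ennreal ((1 + K) * \<eta> * (b (m + 2 ^ r0) - b m))"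
    using pos t by (intro ennreal_leI mult_right_mono) (auto simp: algebra_simps)
  finally show ?case by simp
next
  case (Suc j)
  let ?r = "r0 + j"
  have le: "(2::nat) ^ ?r \<le> 2 * M" "M \<le> m + 2 ^ ?r" using Suc.prems by simp_all
  have pos: "0 < b (m + 2 ^ ?r) - b m" "0 < b (m + 2 ^ ?r + 2 ^ ?r) - b (m + 2 ^ ?r)"
    using b by (simp_all add: strict_mono_less)
  have "emeasure lborel (tree_slice b \<eta> (Suc ?r) m t) \<le>
      emeasure lborel (tree_slice b \<eta> ?r m t) + emeasure lborel
       ((+) (- (real (Suc ?r) * \<eta> * (b (m + 2 ^ ?r) - b m))) ` tree_slice b \<eta> ?r (m + 2 ^ ?r) t)"
    unfolding tree_slice_Suc
    by (intro emeasure_subadditive) (auto simp: tree_slice_def image_UN image_add_atLeastAtMost)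
  also have "\<dots> = emeasure lborel (tree_slice b \<eta> ?r m t) + emeasure lborel (tree_slice b \<eta> ?r (m + 2 ^ ?r) t)"
    by (subst emeasure_lborel_plus) simp_all
  also have "\<dots> \<le> ennreal ((1 + K) * \<eta> * (b (m + 2 ^ ?r) - b m))
      + ennreal ((1 + K) * \<eta> * (b (m + 2 ^ ?r + 2 ^ ?r) - b (m + 2 ^ ?r)))"
    using Suc.IH[of m] Suc.IH[of "m + 2 ^ ?r"] Suc.prems(1) le by (intro add_mono) auto
  also have "\<dots> = ennreal ((1 + K) * \<eta> * (b (m + 2 ^ Suc ?r) - b m))"
  proof -
    have "0 \<le> (1 + K) * \<eta> * (b (m + 2 ^ ?r) - b m)"
      "0 \<le> (1 + K) * \<eta> * (b (m + 2 ^ ?r + 2 ^ ?r) - b (m + 2 ^ ?r))"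
      using pos K \<eta> by simp_all
    moreover have "b (m + 2 ^ Suc ?r) = b (m + 2 ^ ?r + 2 ^ ?r)" by (simp add: mult_2 add.assoc)
    ultimately show ?thesis by (subst ennreal_plus[symmetric]) (simp_all add: right_diff_distrib)
  qed
  finally show ?case by (simp only: add_Suc_right)
qed

text \<open>The lower bound says that a triangle of the left half is never moved further than the whole right
  half is; this is what keeps the shifts ordered across a split.\<close>

lemma perron_shift_bounds:
  fixes b :: "nat \<Rightarrow> real"
  assumes b: "mono b" and \<eta>: "\<eta> \<ge> 0"
  shows "m < k \<Longrightarrow> perron_shift b \<eta> r m k \<le> 0 \<and>
     - (real r * \<eta> * (b (k - 1) - b m)) \<le> perron_shift b \<eta> r m k"
proof (induction r arbitrary: m)
  case 0
  then show ?case by simp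
next
  case (Suc r)
  have mk: "b m \<le> b (k - 1)" using Suc.prems by (intro monoD[OF b]) simp
  then have e: "0 \<le> \<eta> * (b (k - 1) - b m)" using \<eta> by simp
  show ?case
  proof (cases "k \<le> m + 2 ^ r")
    case True
    then show ?thesis using Suc.IH[OF Suc.prems] e by (simp add: algebra_simps)
  next
    case False
    have "b m \<le> b (m + 2 ^ r)" "b (m + 2 ^ r) \<le> b (k - 1)" using False by (auto intro!: monoD[OF b])
    then have "0 \<le> real (Suc r) * \<eta> * (b (m + 2 ^ r) - b m)" "0 \<le> \<eta> * (b (k - 1) - b (m + 2 ^ r))"
      using \<eta> by simp_all
    then show ?thesis using False Suc.IH[of "m + 2 ^ r"] by (simp add: algebra_simps)
  qed
qed

lemma perron_shift_antimono:
  fixes b :: "nat \<Rightarrow> real"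
  assumes b: "mono b" and \<eta>: "\<eta> \<ge> 0"
  shows "m < k \<Longrightarrow> k \<le> k' \<Longrightarrow> perron_shift b \<eta> r m k' \<le> perron_shift b \<eta> r m k"
proof (induction r arbitrary: m)
  case 0
  then show ?case by simp
next
  case (Suc r)
  consider "k' \<le> m + 2 ^ r" | "k \<le> m + 2 ^ r" "m + 2 ^ r < k'" | "m + 2 ^ r < k" by linarith
  then show ?case
  proof cases
    case 2
    have le: "b m \<le> b (m + 2 ^ r)" "b (k - 1) \<le> b (m + 2 ^ r)"
      using 2 by (auto intro!: monoD[OF b])
    have "perron_shift b \<eta> (Suc r) m k' \<le> - (real (Suc r) * \<eta> * (b (m + 2 ^ r) - b m))"
      using 2 perron_shift_bounds[OF b \<eta>, of "m + 2 ^ r" k' r] by simp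
    also have "\<dots> \<le> - (real r * \<eta> * (b (m + 2 ^ r) - b m))"
      using le \<eta> by (auto intro!: mult_right_mono)
    also have "\<dots> \<le> - (real r * \<eta> * (b (k - 1) - b m))"
      using le \<eta> by (auto intro!: mult_left_mono)
    also have "\<dots> \<le> perron_shift b \<eta> (Suc r) m k"
      using 2 perron_shift_bounds[OF b \<eta>, of m k r] Suc.prems by simp
    finally show ?thesis .
  qed (use Suc in auto)
qed

section \<open>Explicit form of the rectangles\<close>

lemma convex_hull_parallelogram:
  fixes p e v :: "'a::real_vector"
  shows "convex hull {p, p + e, p + e + v, p + v} =
    {p + \<alpha> *\<^sub>R e + \<beta> *\<^sub>R v | \<alpha> \<beta>. 0 \<le> \<alpha> \<and> \<alpha> \<le> 1 \<and> 0 \<le> \<beta> \<and> \<beta> \<le> 1}" (is "?H = ?S")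
proof
  have "?S = (\<lambda>z. p + z) ` ((\<lambda>(\<alpha>, \<beta>). \<alpha> *\<^sub>R e + \<beta> *\<^sub>R v) ` ({0..1} \<times> {0..1}))"
  proof -
    have "?S = (\<lambda>(\<alpha>, \<beta>). p + (\<alpha> *\<^sub>R e + \<beta> *\<^sub>R v)) ` ({0..1} \<times> {0..1})"
      by (force simp: add.assoc)
    then show ?thesis by (simp add: image_image case_prod_unfold)
  qed
  moreover have "convex \<dots>"
    by (intro convex_translation convex_linear_image convex_Times convex_real_interval)
       (auto simp: linear_iff algebra_simps)
  ultimately have "convex ?S" by simp
  moreover have "{p, p + e, p + e + v, p + v} \<subseteq> ?S"
  proof -
    have "\<exists>\<alpha> \<beta>. p + x *\<^sub>R e + y *\<^sub>R v = p + \<alpha> *\<^sub>R e + \<beta> *\<^sub>R v \<and> 0 \<le> \<alpha> \<and> \<alpha> \<le> 1 \<and> 0 \<le> \<beta> \<and> \<beta> \<le> 1"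
      if "x \<in> {0,1}" "y \<in> {0,1}" for x y :: real
      using that by (intro exI[of _ x] exI[of _ y]) auto
    from this[of 0 0] this[of 1 0] this[of 0 1] this[of 1 1] show ?thesis by auto
  qed
  ultimately show "?H \<subseteq> ?S" by (rule hull_minimal[rotated])
next
  show "?S \<subseteq> ?H"
  proof
    fix x assume "x \<in> ?S"
    then obtain \<alpha> \<beta> where x: "x = p + \<alpha> *\<^sub>R e + \<beta> *\<^sub>R v" and ab: "0 \<le> \<alpha>" "\<alpha> \<le> 1" "0 \<le> \<beta>" "\<beta> \<le> 1"
      by blast
    have mem: "p \<in> ?H" "p + e \<in> ?H" "p + e + v \<in> ?H" "p + v \<in> ?H" by (auto intro: hull_inc)
    have y: "(1 - \<alpha>) *\<^sub>R p + \<alpha> *\<^sub>R (p + e) \<in> ?H"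
      using convexD[OF convex_convex_hull mem(1,2)] ab by simp
    have z: "(1 - \<alpha>) *\<^sub>R (p + v) + \<alpha> *\<^sub>R (p + e + v) \<in> ?H"
      using convexD[OF convex_convex_hull mem(4,3)] ab by simp
    have "(1 - \<beta>) *\<^sub>R ((1 - \<alpha>) *\<^sub>R p + \<alpha> *\<^sub>R (p + e)) + \<beta> *\<^sub>R ((1 - \<alpha>) *\<^sub>R (p + v) + \<alpha> *\<^sub>R (p + e + v)) \<in> ?H"
      using convexD[OF convex_convex_hull y z] ab by simp
    then show "x \<in> ?H" by (simp add: x algebra_simps)
  qed
qed

text \<open>If both \<open>Q\<close> and \<open>w + Q\<close> are symmetric, then \<open>Q\<close> is invariant under translation by
  \<open>2 w\<close>; a point of \<open>Q\<close> extremal in the direction \<open>w\<close> forces \<open>w = 0\<close>.\<close>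

lemma centered_translate_eqI:
  assumes Q: "compact Q" "Q \<noteq> {}" "uminus ` Q = Q" and S: "Q = (+) v ` S"
  shows "centered_translate S = Q"
  unfolding centered_translate_def
proof (rule the_equality)
  fix Q' assume "(\<exists>v. Q' = (+) v ` S) \<and> uminus ` Q' = Q'"
  then obtain v' where v': "Q' = (+) v' ` S" and sym: "uminus ` Q' = Q'" by blast
  define w where "w = v' - v"
  have Q': "Q' = (+) w ` Q" by (auto simp: S v' w_def image_image)
  have "continuous_on Q (\<lambda>y. y \<bullet> w)" by (intro continuous_intros)
  then obtain x where x: "x \<in> Q" "\<And>y. y \<in> Q \<Longrightarrow> y \<bullet> w \<le> x \<bullet> w"
    using continuous_attains_sup[OF Q(1,2)] by blast
  have "- (w + x) \<in> Q'" using x(1) sym Q' by blast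
  then obtain y where y: "y \<in> Q" "- (w + x) = w + y" using Q' by blast
  then have "- y \<in> Q" using Q(3) by blast
  moreover have "y = - (w + x) - w" using y(2) by (metis add_diff_cancel_left')
  then have "- y = x + 2 *\<^sub>R w" by (simp add: scaleR_2)
  ultimately have "x \<bullet> w + 2 * (w \<bullet> w) \<le> x \<bullet> w" using x(2) by (metis inner_add_left inner_scaleR_left)
  moreover have "0 \<le> w \<bullet> w" by simp
  ultimately have "w \<bullet> w = 0" by linarith
  then have "w = 0" by simp
  then show "Q' = Q" using Q' by simp
qed (use Q S in blast)

text \<open>The centred rectangle with sides along \<open>(c, -1)\<close> and \<open>(1, c)\<close>, for \<open>a = b (k - 1)\<close> and
  \<open>c = b k\<close>, as an intersection of two slabs.  The two directions are left unnormalised: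
  \<open>1 + c\<^sup>2\<close> is the squared length of \<open>(c, -1)\<close>, and \<open>a - c\<close> is the inner product of
  \<open>(a, -1)\<close> with \<open>(1, c)\<close>.  The factor \<open>3 / 4\<close> is half of the homothety ratio \<open>3 / 2\<close>.\<close>

definition slab_rect :: "real \<Rightarrow> real \<Rightarrow> real \<Rightarrow> (real \<times> real) set" where
  "slab_rect a c \<delta> = {p. \<bar>fst p * c - snd p\<bar> \<le> 3 / 4 * \<delta> * (1 + c\<^sup>2) \<and>
                         \<bar>fst p + snd p * c\<bar> \<le> 3 / 4 * \<delta> * (c - a)}"

lemma slab_rect_param:
  assumes "a < c"
  defines "e \<equiv> (3 / 2) *\<^sub>R (c, - 1)" and "v \<equiv> (- (3 / 2) * ((c - a) / (1 + c\<^sup>2))) *\<^sub>R (1, c)"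
  shows "slab_rect a c 1 = (\<lambda>(\<alpha>, \<beta>). \<alpha> *\<^sub>R e + \<beta> *\<^sub>R v) ` ({- 1 / 2 .. 1 / 2} \<times> {- 1 / 2 .. 1 / 2})" (is "_ = ?S")
proof
  have L: "0 < 1 + c\<^sup>2" by (simp add: add_pos_nonneg)
  have d: "0 < c - a" using assms by simp
  show "slab_rect a c 1 \<subseteq> ?S"
  proof
    fix p assume p: "p \<in> slab_rect a c 1"
    obtain x y where xy: "p = (x, y)" by fastforce
    define \<alpha> where "\<alpha> = (x * c - y) / (3 / 2 * (1 + c\<^sup>2))"
    define \<beta> where "\<beta> = - (x + y * c) / (3 / 2 * (c - a))"
    have "\<bar>\<alpha>\<bar> \<le> 1 / 2" "\<bar>\<beta>\<bar> \<le> 1 / 2"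
      using p L d by (simp_all add: slab_rect_def xy \<alpha>_def \<beta>_def abs_divide divide_le_eq) (simp_all add: abs_if split: if_splits)
    then have "\<alpha> \<in> {- 1 / 2 .. 1 / 2}" "\<beta> \<in> {- 1 / 2 .. 1 / 2}" by (auto simp: abs_le_iff)
    moreover have "p = \<alpha> *\<^sub>R e + \<beta> *\<^sub>R v"
    proof -
      have A: "\<alpha> * (3 / 2) = (x * c - y) / (1 + c\<^sup>2)"
        using L by (simp add: \<alpha>_def divide_simps) (simp add: algebra_simps)
      have B: "\<beta> * (- (3 / 2) * ((c - a) / (1 + c\<^sup>2))) = (x + y * c) / (1 + c\<^sup>2)"
        using d L by (simp add: \<beta>_def divide_simps) (simp add: algebra_simps)
      have "\<alpha> *\<^sub>R e + \<beta> *\<^sub>R v = ((x * c - y) / (1 + c\<^sup>2)) *\<^sub>R (c, - 1) + ((x + y * c) / (1 + c\<^sup>2)) *\<^sub>R (1, c)"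
        unfolding e_def v_def scaleR_scaleR A B ..
      also have "\<dots> = (x, y)"
        using L by (simp add: divide_simps) (simp add: algebra_simps power2_eq_square)
      finally show ?thesis by (simp add: xy)
    qed
    ultimately show "p \<in> ?S" by force
  qed
  show "?S \<subseteq> slab_rect a c 1"
  proof
    fix p assume "p \<in> ?S"
    then obtain \<alpha> \<beta> where ab: "\<alpha> \<in> {- 1 / 2 .. 1 / 2}" "\<beta> \<in> {- 1 / 2 .. 1 / 2}"
      and p_def: "p = \<alpha> *\<^sub>R e + \<beta> *\<^sub>R v"
      by (elim imageE SigmaE) simp
    have 1: "fst p * c - snd p = \<alpha> * (3 / 2 * (1 + c\<^sup>2))"
      by (simp add: p_def e_def v_def algebra_simps power2_eq_square)
    define z where "z = (c - a) / (1 + c\<^sup>2)"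
    have "fst p + snd p * c = - \<beta> * (3 / 2 * z) * (1 + c\<^sup>2)"
    proof -
      have v: "v = (- (3 / 2) * z) *\<^sub>R (1, c)" by (simp only: v_def z_def)
      show ?thesis by (simp add: p_def e_def v algebra_simps power2_eq_square)
    qed
    moreover have "z * (1 + c\<^sup>2) = c - a" using L by (simp add: z_def)
    ultimately have 2: "fst p + snd p * c = - \<beta> * (3 / 2 * (c - a))" by (simp only: mult.assoc)
    have "\<bar>\<alpha>\<bar> \<le> 1 / 2" "\<bar>\<beta>\<bar> \<le> 1 / 2" using ab by (auto simp: abs_le_iff)
    then have "\<bar>\<alpha>\<bar> * (3 / 2 * (1 + c\<^sup>2)) \<le> 1 / 2 * (3 / 2 * (1 + c\<^sup>2))"
      "\<bar>\<beta>\<bar> * (3 / 2 * (c - a)) \<le> 1 / 2 * (3 / 2 * (c - a))"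
      using L d by (intro mult_right_mono; simp)+
    then show "p \<in> slab_rect a c 1"
      unfolding slab_rect_def mem_Collect_eq 1 2 using L d by (simp add: abs_mult)
  qed
qed

text \<open>The vector \<open>v\<close> is the component orthogonal to \<open>e\<close> of the vector from \<open>A\<close> to the image of
  \<open>B\<^bsub>k-1\<^esub>\<close>.  The foot of that perpendicular lies on the side \<open>e\<close> because
  \<open>0 \<le> b (k - 1) < b k\<close>, so the rectangle spanned by \<open>e\<close> and \<open>v\<close> contains the triangle.  Any other
  competitor reaches at least as far in the direction \<open>v\<close>.\<close>

lemma tilde_P_eq:
  assumes b: "strict_mono b" "b 0 = 0" and k: "1 \<le> k"
  defines "c \<equiv> b k" and "a \<equiv> b (k - 1)"
  defines "e \<equiv> (3 / 2) *\<^sub>R (c, - 1)" and "v \<equiv> (- (3 / 2) * ((c - a) / (1 + c\<^sup>2))) *\<^sub>R (1, c)"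
  shows "tilde_P b k = convex hull {ptA, ptA + e, ptA + e + v, ptA + v}"
proof -
  have L: "0 < 1 + c\<^sup>2" by (simp add: add_pos_nonneg)
  have ac: "a < c" using b(1) k by (simp add: a_def c_def strict_mono_less)
  have a0: "0 \<le> a" using strict_mono_less_eq[OF b(1), of 0 "k - 1"] b(2) by (simp add: a_def)
  \<comment> \<open>The position of the foot of the perpendicular, as a fraction of the side \<open>e\<close>.\<close>
  define \<alpha>0 where "\<alpha>0 = (1 + a * c) / (1 + c\<^sup>2)"
  have "a * c \<le> c * c" using a0 ac by (intro mult_right_mono) auto
  then have \<alpha>0: "0 \<le> \<alpha>0" "\<alpha>0 \<le> 1" using L a0 ac by (auto simp: \<alpha>0_def power2_eq_square)
  have B: "ptB' b k = ptA + e" by (simp add: ptB'_def ptB_def ptA_def e_def c_def)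
  have B': "ptB' b (k - 1) = ptA + \<alpha>0 *\<^sub>R e + 1 *\<^sub>R v"
    unfolding ptB'_def ptB_def ptA_def e_def v_def \<alpha>0_def a_def[symmetric]
    using L by (simp add: divide_simps) (simp add: algebra_simps power2_eq_square)
  have ev: "e \<noteq> 0" "v \<noteq> 0" "v \<bullet> e = 0" using ac L by (simp_all add: e_def v_def zero_prod_def)
  show ?thesis unfolding tilde_P_def B
  proof (rule Least_equality)
    have "{ptA, ptB' b (k - 1), ptA + e} \<subseteq> convex hull {ptA, ptA + e, ptA + e + v, ptA + v}"
    proof -
      have "ptB' b (k - 1) \<in> convex hull {ptA, ptA + e, ptA + e + v, ptA + v}"
        unfolding B' convex_hull_parallelogram using \<alpha>0
        by (intro CollectI exI[of _ \<alpha>0] exI[of _ 1]) simp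
      then show ?thesis by (auto intro: hull_inc)
    qed
    then have "convex hull {ptA, ptB' b (k - 1), ptA + e} \<subseteq> convex hull {ptA, ptA + e, ptA + e + v, ptA + v}"
      by (intro hull_minimal) auto
    moreover have "rectangle_with_side ptA (ptA + e) (convex hull {ptA, ptA + e, ptA + e + v, ptA + v})"
      unfolding rectangle_with_side_def using ev by (intro conjI exI[of _ v]) auto
    ultimately show "rectangle_with_side ptA (ptA + e) (convex hull {ptA, ptA + e, ptA + e + v, ptA + v}) \<and>
      convex hull {ptA, ptB' b (k - 1), ptA + e} \<subseteq> convex hull {ptA, ptA + e, ptA + e + v, ptA + v}" by simp
  next
    fix R assume R: "rectangle_with_side ptA (ptA + e) R \<and> convex hull {ptA, ptB' b (k - 1), ptA + e} \<subseteq> R"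
    then obtain v' where v': "v' \<bullet> e = 0" and R': "R = convex hull {ptA, ptA + e, ptA + e + v', ptA + v'}"
      unfolding rectangle_with_side_def by auto
    have "ptB' b (k - 1) \<in> R" using R by (meson hull_inc insertCI subsetD)
    then obtain \<alpha> \<beta> where ab: "ptB' b (k - 1) = ptA + \<alpha> *\<^sub>R e + \<beta> *\<^sub>R v'" "0 \<le> \<beta>" "\<beta> \<le> 1"
      unfolding R' convex_hull_parallelogram by blast
    then have eq: "\<alpha>0 *\<^sub>R e + v = \<alpha> *\<^sub>R e + \<beta> *\<^sub>R v'" using B' by (simp add: add.assoc)
    \<comment> \<open>Both \<open>v\<close> and \<open>v'\<close> are orthogonal to \<open>e\<close>, so the components along \<open>e\<close> agree.\<close>
    have "(\<alpha>0 *\<^sub>R e + v) \<bullet> e = (\<alpha> *\<^sub>R e + \<beta> *\<^sub>R v') \<bullet> e" by (simp only: eq)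
    then have "\<alpha>0 * (e \<bullet> e) = \<alpha> * (e \<bullet> e)" using ev(3) v' by (simp add: inner_add_left)
    then have "\<alpha>0 = \<alpha>" using ev(1) by simp
    then have v: "v = \<beta> *\<^sub>R v'" using eq by simp
    have mem: "ptA + x *\<^sub>R e + y *\<^sub>R v' \<in> R" if "0 \<le> x" "x \<le> 1" "0 \<le> y" "y \<le> 1" for x y
      unfolding R' convex_hull_parallelogram using that by blast
    have "{ptA, ptA + e, ptA + e + v, ptA + v} \<subseteq> R"
      using mem[of 0 0] mem[of 1 0] mem[of 1 \<beta>] mem[of 0 \<beta>] ab(2,3) by (simp add: v)
    then show "convex hull {ptA, ptA + e, ptA + e + v, ptA + v} \<le> R"
      by (intro hull_minimal) (auto simp: R')
  qed
qed

lemma rect_P_eq: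
  assumes b: "strict_mono b" "b 0 = 0" and k: "1 \<le> k"
  shows "rect_P b k = slab_rect (b (k - 1)) (b k) 1"
proof -
  define c a where "c = b k" and "a = b (k - 1)"
  define e where "e = (3 / 2) *\<^sub>R (c, - 1 :: real)"
  define v where "v = (- (3 / 2) * ((c - a) / (1 + c\<^sup>2))) *\<^sub>R (1 :: real, c)"
  have ac: "a < c" using b(1) k by (simp add: a_def c_def strict_mono_less)
  note Q = slab_rect_param[OF ac, folded e_def v_def]
  show ?thesis unfolding rect_P_def a_def[symmetric] c_def[symmetric]
  proof (rule centered_translate_eqI)
    show "compact (slab_rect a c 1)" unfolding Q
      by (intro compact_continuous_image compact_Times compact_Icc)
         (auto simp: case_prod_unfold intro!: continuous_intros)
    show "slab_rect a c 1 \<noteq> {}" unfolding Q by auto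
    show "uminus ` slab_rect a c 1 = slab_rect a c 1"
    proof -
      have neg: "- p \<in> slab_rect a c 1" if "p \<in> slab_rect a c 1" for p
      proof -
        have "fst (- p) * c - snd (- p) = - (fst p * c - snd p)"
          "fst (- p) + snd (- p) * c = - (fst p + snd p * c)" by simp_all
        then show ?thesis using that by (simp only: slab_rect_def mem_Collect_eq abs_minus_cancel)
      qed
      show ?thesis
      proof
        show "uminus ` slab_rect a c 1 \<subseteq> slab_rect a c 1" using neg by blast
        show "slab_rect a c 1 \<subseteq> uminus ` slab_rect a c 1"
        proof
          fix p assume "p \<in> slab_rect a c 1"
          then show "p \<in> uminus ` slab_rect a c 1" using neg by (intro image_eqI[of _ _ "- p"]) auto
        qed
      qed
    qed
    show "slab_rect a c 1 = (+) (- ptA - (1 / 2) *\<^sub>R e - (1 / 2) *\<^sub>R v) ` tilde_P b k"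
    proof -
      have "tilde_P b k = (\<lambda>(\<alpha>, \<beta>). ptA + \<alpha> *\<^sub>R e + \<beta> *\<^sub>R v) ` ({0..1} \<times> {0..1})"
        unfolding tilde_P_eq[OF b k, folded a_def c_def, folded e_def v_def] convex_hull_parallelogram
        by force
      also have "{0..1::real} = (\<lambda>x. x + 1 / 2) ` {- 1 / 2 .. 1 / 2}" by simp
      finally have "(+) (- ptA - (1 / 2) *\<^sub>R e - (1 / 2) *\<^sub>R v) ` tilde_P b k =
        (\<lambda>(\<alpha>, \<beta>). - ptA - (1 / 2) *\<^sub>R e - (1 / 2) *\<^sub>R v + (ptA + (\<alpha> + 1 / 2) *\<^sub>R e + (\<beta> + 1 / 2) *\<^sub>R v)) `
          ({- 1 / 2 .. 1 / 2} \<times> {- 1 / 2 .. 1 / 2})"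
        by (simp only: map_prod_surj_on[OF refl refl, symmetric] image_image case_prod_unfold fst_map_prod snd_map_prod)
      also have "\<dots> = slab_rect a c 1" unfolding Q by (intro image_cong refl) (auto simp: algebra_simps)
      finally show ?thesis by simp
    qed
  qed
qed

lemma rect_R_eq:
  assumes b: "strict_mono b" "b 0 = 0" and k: "1 \<le> k" and \<delta>: "\<And>n. 0 < \<delta> n"
  shows "rect_R b \<delta> k = slab_rect (b (k - 1)) (b k) (\<delta> (dyadic_index k))"
proof -
  define s where "s = \<delta> (dyadic_index k)"
  have s: "0 < s" using \<delta> by (simp add: s_def)
  have *: "s *\<^sub>R p \<in> slab_rect a c (s * t) \<longleftrightarrow> p \<in> slab_rect a c t" if "0 < s" for a c p s t
  proof -
    have eqs: "fst (s *\<^sub>R p) * c - snd (s *\<^sub>R p) = s * (fst p * c - snd p)"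
      "fst (s *\<^sub>R p) + snd (s *\<^sub>R p) * c = s * (fst p + snd p * c)"
      "3 / 4 * (s * t) * (1 + c\<^sup>2) = s * (3 / 4 * t * (1 + c\<^sup>2))"
      "3 / 4 * (s * t) * (c - a) = s * (3 / 4 * t * (c - a))"
      by (simp_all add: algebra_simps)
    have "\<bar>s * x\<bar> \<le> s * y \<longleftrightarrow> \<bar>x\<bar> \<le> y" for x y using that by (simp add: abs_mult)
    then show ?thesis by (simp only: slab_rect_def mem_Collect_eq eqs)
  qed
  have "(*\<^sub>R) s ` slab_rect a c 1 = slab_rect a c s" for a c
  proof
    show "(*\<^sub>R) s ` slab_rect a c 1 \<subseteq> slab_rect a c s"
    proof
      fix q assume "q \<in> (*\<^sub>R) s ` slab_rect a c 1"
      then obtain p where "p \<in> slab_rect a c 1" "q = s *\<^sub>R p" by blast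
      then show "q \<in> slab_rect a c s" using *[OF s, of p a c 1] by simp
    qed
    show "slab_rect a c s \<subseteq> (*\<^sub>R) s ` slab_rect a c 1"
    proof
      fix p assume p: "p \<in> slab_rect a c s"
      have eq: "s *\<^sub>R ((1 / s) *\<^sub>R p) = p" using s by simp
      then have "(1 / s) *\<^sub>R p \<in> slab_rect a c 1" using p *[OF s, of "(1 / s) *\<^sub>R p" a c 1] by simp
      then show "p \<in> (*\<^sub>R) s ` slab_rect a c 1" using eq by (intro image_eqI[where x = "(1 / s) *\<^sub>R p"]) simp_all
    qed
  qed
  then show ?thesis unfolding rect_R_def rect_P_eq[OF b k] s_def[symmetric] .
qed

lemma dyadic_index_eq:
  assumes "2 ^ n \<le> k" "k < 2 ^ (n + 1)"
  shows "dyadic_index k = n"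
  unfolding dyadic_index_def
proof (rule the_equality)
  fix j assume j: "2 ^ j \<le> k \<and> k < 2 ^ (j + 1)"
  have "(2::nat) ^ j < 2 ^ (n + 1)" "(2::nat) ^ n < 2 ^ (j + 1)" using assms j by linarith+
  then have "j < n + 1" "n < j + 1"
    using power_less_imp_less_exp[of "2::nat" j "n + 1"] power_less_imp_less_exp[of "2::nat" n "j + 1"] by linarith+
  then show "j = n" by simp
qed (use assms in simp)

section \<open>Areas by horizontal slices\<close>

lemma emeasure_horizontal_slices:
  fixes A :: "(real \<times> real) set"
  assumes "A \<in> sets borel"
  shows "emeasure lborel A = (\<integral>\<^sup>+y. emeasure lborel {x. (x, y) \<in> A} \<partial>lborel)"
proof -
  have "A \<in> sets (lborel \<Otimes>\<^sub>M lborel)" by (metis assms lborel_prod sets_lborel)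
  then have "emeasure (lborel \<Otimes>\<^sub>M lborel) A = (\<integral>\<^sup>+y. emeasure lborel ((\<lambda>x. (x, y)) -` A) \<partial>lborel)"
    by (rule lborel_pair.emeasure_pair_measure_alt2)
  then show ?thesis by (simp add: lborel_prod vimage_def)
qed

lemma emeasure_le_by_slices:
  fixes A :: "(real \<times> real) set"
  assumes A: "A \<in> sets borel" and pq: "p \<le> q" and w: "0 \<le> w"
    and out: "\<And>x y. (x, y) \<in> A \<Longrightarrow> y \<in> {p..q}"
    and le: "\<And>y. y \<in> {p..q} \<Longrightarrow> emeasure lborel {x. (x, y) \<in> A} \<le> ennreal w"
  shows "emeasure lborel A \<le> ennreal (w * (q - p))"
proof -
  have "emeasure lborel A \<le> (\<integral>\<^sup>+y. ennreal w * indicator {p..q} y \<partial>lborel)"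
    unfolding emeasure_horizontal_slices[OF A]
  proof (rule nn_integral_mono)
    fix y
    show "emeasure lborel {x. (x, y) \<in> A} \<le> ennreal w * indicator {p..q} y"
    proof (cases "y \<in> {p..q}")
      case False
      then have "{x. (x, y) \<in> A} = {}" using out by blast
      then show ?thesis by simp
    qed (use le in simp)
  qed
  also have "\<dots> = ennreal (w * (q - p))" using pq w by (simp add: nn_integral_cmult ennreal_mult)
  finally show ?thesis .
qed

lemma emeasure_ge_by_slices:
  fixes A :: "(real \<times> real) set"
  assumes A: "A \<in> sets borel" and pq: "p \<le> q" and w: "0 \<le> w"
    and ge: "\<And>y. y \<in> {p..q} \<Longrightarrow> ennreal w \<le> emeasure lborel {x. (x, y) \<in> A}"
  shows "ennreal (w * (q - p)) \<le> emeasure lborel A"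
proof -
  have "ennreal (w * (q - p)) = (\<integral>\<^sup>+y. ennreal w * indicator {p..q} y \<partial>lborel)"
    using pq w by (simp add: nn_integral_cmult ennreal_mult)
  also have "\<dots> \<le> emeasure lborel A"
    unfolding emeasure_horizontal_slices[OF A]
  proof (rule nn_integral_mono)
    fix y
    show "ennreal w * indicator {p..q} y \<le> emeasure lborel {x. (x, y) \<in> A}"
      using ge[of y] by (cases "y \<in> {p..q}") auto
  qed
  finally show ?thesis .
qed

lemma closed_slab_rect: "closed (slab_rect a c \<delta>)"
  unfolding slab_rect_def
  by (intro closed_Collect_conj closed_Collect_le) (auto intro!: continuous_intros)

text \<open>An upper bound suffices: horizontal slices of the second slab have length
  \<open>3 / 2 * \<delta> * (c - a)\<close>, and both slabs together confine the rectangle to heights at most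
  \<open>3 / 2 * \<delta>\<close> because \<open>c - a \<le> c\<close>.\<close>

lemma emeasure_slab_rect_le:
  assumes a: "0 \<le> a" "a < c" and \<delta>: "0 < \<delta>"
  shows "emeasure lborel (slab_rect a c \<delta>) \<le> ennreal (9 / 2 * \<delta>\<^sup>2 * (c - a))"
proof -
  have L: "0 < 1 + c\<^sup>2" by (simp add: add_pos_nonneg)
  have "emeasure lborel (slab_rect a c \<delta>) \<le> ennreal ((3 / 2 * \<delta> * (c - a)) * (3 / 2 * \<delta> - (- (3 / 2 * \<delta>))))"
  proof (rule emeasure_le_by_slices)
    show "slab_rect a c \<delta> \<in> sets borel" using closed_slab_rect by (rule borel_closed)
    fix x y assume xy: "(x, y) \<in> slab_rect a c \<delta>"
    define P where "P = x * c - y"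
    define Q where "Q = x + y * c"
    have PQ: "\<bar>P\<bar> \<le> 3 / 4 * \<delta> * (1 + c\<^sup>2)" "\<bar>Q\<bar> \<le> 3 / 4 * \<delta> * (c - a)"
      using xy by (simp_all add: slab_rect_def P_def Q_def)
    have "y * (1 + c\<^sup>2) = Q * c - P" by (simp add: P_def Q_def algebra_simps power2_eq_square)
    then have "\<bar>y\<bar> * (1 + c\<^sup>2) = \<bar>Q * c - P\<bar>" by (metis L abs_mult abs_of_pos)
    also have "\<dots> \<le> \<bar>Q * c\<bar> + \<bar>P\<bar>" by (rule abs_triangle_ineq4)
    also have "\<bar>Q * c\<bar> = \<bar>Q\<bar> * c" using a by (simp add: abs_mult)
    also have "\<bar>Q\<bar> * c \<le> 3 / 4 * \<delta> * (c - a) * c" using PQ a by (intro mult_right_mono) auto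
    also have "\<dots> \<le> 3 / 4 * \<delta> * c * c" using a \<delta> by (intro mult_right_mono mult_left_mono) auto
    also have "\<dots> \<le> 3 / 4 * \<delta> * (1 + c\<^sup>2)" using \<delta> by (simp add: power2_eq_square)
    finally have "\<bar>y\<bar> * (1 + c\<^sup>2) \<le> (3 / 2 * \<delta>) * (1 + c\<^sup>2)" using PQ(1) by simp
    then have "\<bar>y\<bar> \<le> 3 / 2 * \<delta>" using L by (rule mult_right_le_imp_le)
    then show "y \<in> {- (3 / 2 * \<delta>) .. 3 / 2 * \<delta>}" by (auto simp: abs_le_iff)
  next
    fix y :: real
    define w where "w = 3 / 4 * \<delta> * (c - a)"
    have w: "0 \<le> w" using a \<delta> by (simp add: w_def)
    have "{x. (x, y) \<in> slab_rect a c \<delta>} \<subseteq> {x. \<bar>x + y * c\<bar> \<le> w}"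
      unfolding slab_rect_def w_def by auto
    also have "\<dots> \<subseteq> {- y * c - w .. - y * c + w}" by (auto simp: abs_le_iff)
    finally have "emeasure lborel {x. (x, y) \<in> slab_rect a c \<delta>} \<le> emeasure lborel {- y * c - w .. - y * c + w}"
      by (intro emeasure_mono) auto
    also have "\<dots> = ennreal (3 / 2 * \<delta> * (c - a))"
      using w by (subst emeasure_lborel_Icc) (auto simp: w_def)
    finally show "emeasure lborel {x. (x, y) \<in> slab_rect a c \<delta>} \<le> ennreal (3 / 2 * \<delta> * (c - a))" .
  qed (use a \<delta> in auto)
  then show ?thesis by (simp add: power2_eq_square algebra_simps)
qed

section \<open>Averages over the rectangles\<close>

text \<open>The cone between the directions \<open>(a, -1)\<close> and \<open>(c, -1)\<close> at the apex \<open>(s, 0)\<close>, cut off at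
  depth \<open>h\<close>.\<close>

definition triangle_below :: "real \<Rightarrow> real \<Rightarrow> real \<Rightarrow> real \<Rightarrow> (real \<times> real) set" where
  "triangle_below s a c h = {p. - h \<le> snd p \<and> snd p \<le> 0 \<and>
     s - snd p * a \<le> fst p \<and> fst p \<le> s - snd p * c}"

text \<open>A piece of the opposite cone.  The heights stop at \<open>h / 4\<close> so that a rectangle centred in the
  piece still reaches depth \<open>h / 2\<close>, and start at \<open>h / 8\<close> so that all slices have comparable
  length.  The strict inequality makes neighbouring pieces disjoint rather than almost disjoint.\<close>

definition arm_above :: "real \<Rightarrow> real \<Rightarrow> real \<Rightarrow> real \<Rightarrow> (real \<times> real) set" where
  "arm_above s a c h = {p. h / 8 \<le> snd p \<and> snd p \<le> h / 4 \<and>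
     s - snd p * c \<le> fst p \<and> fst p < s - snd p * a}"

lemma closed_triangle_below: "closed (triangle_below s a c h)"
  unfolding triangle_below_def
  by (intro closed_Collect_conj closed_Collect_le) (auto intro!: continuous_intros)

lemma borel_arm_above: "arm_above s a c h \<in> sets borel"
proof -
  have "arm_above s a c h = {p. h / 8 \<le> snd p \<and> snd p \<le> h / 4 \<and> s - snd p * c \<le> fst p}
      \<inter> {p. fst p < s - snd p * a}"
    by (auto simp: arm_above_def)
  moreover have "closed {p :: real \<times> real. h / 8 \<le> snd p \<and> snd p \<le> h / 4 \<and> s - snd p * c \<le> fst p}"
    by (intro closed_Collect_conj closed_Collect_le continuous_intros)
  moreover have "open {p :: real \<times> real. fst p < s - snd p * a}"
    by (intro open_Collect_less continuous_intros)
  ultimately show ?thesis by auto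
qed

text \<open>The difference between a point of the triangle and a point of the opposite cone lies in the cone
  itself, at a depth which is the sum of the depth and the height; up to three quarters of the depth
  scale \<open>\<delta>\<close> this cone is inside the centred rectangle.\<close>

lemma mem_slab_rect:
  assumes "a < c" "0 \<le> t" "t \<le> 3 / 4 * \<delta>" "t * a \<le> x" "x \<le> t * c" "0 \<le> a"
  shows "(x, - t) \<in> slab_rect a c \<delta>"
proof -
  have "0 \<le> t * a" using assms by simp
  then have "0 \<le> x" using assms by linarith
  then have 1: "0 \<le> x * c" "x * c \<le> t * c * c" using assms by (auto intro!: mult_right_mono)
  have 2: "t * (1 + c\<^sup>2) \<le> 3 / 4 * \<delta> * (1 + c\<^sup>2)" "t * (c - a) \<le> 3 / 4 * \<delta> * (c - a)"
    using assms by (intro mult_right_mono; simp)+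
  have "\<bar>x * c + t\<bar> \<le> 3 / 4 * \<delta> * (1 + c\<^sup>2)"
    using 1 2(1) assms(2) by (simp add: abs_le_iff power2_eq_square algebra_simps)
  moreover have "\<bar>x - t * c\<bar> \<le> 3 / 4 * \<delta> * (c - a)"
    using 2(2) assms by (simp add: abs_le_iff algebra_simps)
  ultimately show ?thesis by (simp add: slab_rect_def)
qed

lemma avg_op_indicator:
  assumes "B \<in> sets borel" "(+) x ` R k \<in> sets borel"
  shows "avg_op R k (indicator B) x = measure lborel ((+) x ` R k \<inter> B) / measure lborel (R k)"
proof -
  have "set_lebesgue_integral lborel ((+) x ` R k) (indicator B) =
      (\<integral>z. indicator ((+) x ` R k \<inter> B) z \<partial>lborel)"
    unfolding set_lebesgue_integral_def by (intro Bochner_Integration.integral_cong) (auto simp: indicator_def)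
  also have "\<dots> = measure lborel ((+) x ` R k \<inter> B)"
    using Bochner_Integration.integral_indicator[of lborel "(+) x ` R k \<inter> B"] by simp
  finally show ?thesis using assms by (simp add: avg_op_def)
qed

text \<open>The translated rectangle contains the part of the triangle at depths between \<open>\<delta> / 4\<close> and
  \<open>\<delta> / 2\<close>, whose area is at least \<open>\<delta>\<^sup>2 * (c - a) / 16\<close>, while the rectangle has area at most
  \<open>9 / 2 * \<delta>\<^sup>2 * (c - a)\<close>.  The ratio of the two is \<open>1 / 72\<close>.\<close>

lemma avg_op_ge_on_arm:
  assumes R: "R k = slab_rect a c \<delta>" and ac: "0 \<le> a" "a < c" and \<delta>: "0 < \<delta>"
    and B: "B \<in> sets borel" "emeasure lborel B < \<infinity>" "triangle_below s a c \<delta> \<subseteq> B"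
    and p: "p \<in> arm_above s a c \<delta>"
  shows "1 / 72 \<le> avg_op R k (indicator B) p"
proof -
  define T where "T = {q \<in> triangle_below s a c \<delta>. - (\<delta> / 2) \<le> snd q \<and> snd q \<le> - (\<delta> / 4)}"
  have T: "T \<in> sets borel"
  proof -
    have "T = triangle_below s a c \<delta> \<inter> {q. - (\<delta> / 2) \<le> snd q \<and> snd q \<le> - (\<delta> / 4)}"
      by (auto simp: T_def)
    moreover have "closed \<dots>" 
      by (intro closed_Int closed_triangle_below closed_Collect_conj closed_Collect_le continuous_intros)
    ultimately show ?thesis by (simp add: borel_closed)
  qed
  have "T \<subseteq> (+) p ` R k"
  proof
    fix q assume q: "q \<in> T"
    define t where "t = snd p - snd q"
    have "(fst q - fst p, - t) \<in> slab_rect a c \<delta>"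
    proof (rule mem_slab_rect)
      show "t * a \<le> fst q - fst p" "fst q - fst p \<le> t * c" "0 \<le> t" "t \<le> 3 / 4 * \<delta>"
        using p q \<delta> by (auto simp: T_def triangle_below_def arm_above_def t_def algebra_simps)
    qed (use ac in auto)
    then have "q - p \<in> R k" unfolding R by (simp add: t_def prod_eq_iff minus_prod_def)
    then show "q \<in> (+) p ` R k" by (rule rev_image_eqI) simp
  qed
  then have sub: "T \<subseteq> (+) p ` R k \<inter> B" using B(3) by (auto simp: T_def)
  have meas: "(+) p ` R k \<in> sets borel"
    unfolding R by (intro borel_closed closed_translation closed_slab_rect)
  have "ennreal ((\<delta> / 4 * (c - a)) * (- (\<delta> / 4) - (- (\<delta> / 2)))) \<le> emeasure lborel T"
  proof (rule emeasure_ge_by_slices)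
    fix y assume y: "y \<in> {- (\<delta> / 2) .. - (\<delta> / 4)}"
    have eq: "{x. (x, y) \<in> T} = {s - y * a .. s - y * c}"
      using y \<delta> by (auto simp: T_def triangle_below_def)
    have le: "\<delta> / 4 * (c - a) \<le> - y * (c - a)" using y ac by (intro mult_right_mono) auto
    have "y * c \<le> y * a" using y ac \<delta> by (intro mult_left_mono_neg) auto
    then have "emeasure lborel {x. (x, y) \<in> T} = ennreal (- y * (c - a))"
      unfolding eq by (subst emeasure_lborel_Icc) (auto simp: right_diff_distrib)
    then show "ennreal (\<delta> / 4 * (c - a)) \<le> emeasure lborel {x. (x, y) \<in> T}"
      using le by (simp add: ennreal_leI)
  qed (use T \<delta> ac in auto)
  also have "\<dots> \<le> emeasure lborel ((+) p ` R k \<inter> B)"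
    using sub meas B by (intro emeasure_mono) auto
  finally have lower: "ennreal (\<delta>\<^sup>2 * (c - a) / 16) \<le> emeasure lborel ((+) p ` R k \<inter> B)"
    by (simp add: power2_eq_square mult_ac)
  have fin: "emeasure lborel ((+) p ` R k \<inter> B) < \<infinity>"
    by (rule le_less_trans[OF emeasure_mono B(2)]) (use B in auto)
  have pos: "0 < \<delta>\<^sup>2 * (c - a)" using \<delta> ac by simp
  have lower': "\<delta>\<^sup>2 * (c - a) / 16 \<le> measure lborel ((+) p ` R k \<inter> B)"
    using lower fin pos by (simp add: emeasure_eq_ennreal_measure measure_nonneg)
  have upper: "emeasure lborel (R k) \<le> ennreal (9 / 2 * (\<delta>\<^sup>2 * (c - a)))"
    using emeasure_slab_rect_le[OF ac \<delta>] by (simp add: R mult.assoc)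
  then have Rfin: "emeasure lborel (R k) < \<infinity>" by (rule le_less_trans) simp
  then have upper': "measure lborel (R k) \<le> 9 / 2 * (\<delta>\<^sup>2 * (c - a))"
    using upper pos by (simp add: emeasure_eq_ennreal_measure)
  have "emeasure lborel ((+) p ` R k \<inter> B) \<le> emeasure lborel ((+) p ` R k)"
    using meas by (intro emeasure_mono) auto
  also have "\<dots> = emeasure lborel (R k)"
    unfolding R by (intro emeasure_lborel_plus borel_closed closed_slab_rect)
  finally have "0 < emeasure lborel (R k)"
    using lower pos by (metis divide_pos_pos ennreal_less_zero_iff order_less_le_trans zero_less_numeral)
  then have Rpos: "0 < measure lborel (R k)"
    using Rfin by (simp add: measure_def enn2real_positive_iff)
  show ?thesis
    unfolding avg_op_indicator[of B p R k, OF B(1) meas] using lower' upper' Rpos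
    by (simp add: le_divide_eq)
qed

text \<open>Since \<open>emeasure\<close> is \<open>0\<close> on non-measurable sets, monotonicity can be applied to the superlevel set only once it is known to be Borel.  Each
  average is a parameter integral of a jointly measurable integrand.\<close>

lemma borel_maximal_op_superlevel:
  assumes R: "\<And>k. 1 \<le> k \<Longrightarrow> closed (R k)" and B: "B \<in> sets borel"
  shows "{x. maximal_op R (indicator B) x > ereal l} \<in> sets borel"
proof -
  have "avg_op R k (indicator B) \<in> borel_measurable borel" if k: "1 \<le> k" for k
  proof -
    have "continuous_on UNIV (\<lambda>w :: (real \<times> real) \<times> (real \<times> real). snd w - fst w)"
      by (intro continuous_intros)
    then have cl: "closed {w :: (real \<times> real) \<times> (real \<times> real). snd w - fst w \<in> R k}"
      using continuous_closed_preimage[OF _ closed_UNIV R[OF k]] by (auto simp: vimage_def)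
    have eq: "avg_op R k (indicator B) x = (1 / measure lborel (R k)) *
        (\<integral>z. indicator {w. snd w - fst w \<in> R k} (x, z) * indicator B z \<partial>lborel)" for x
    proof -
      have "z \<in> (+) x ` R k \<longleftrightarrow> z - x \<in> R k" for z by (force simp: image_iff)
      then show ?thesis unfolding avg_op_def set_lebesgue_integral_def by (simp add: indicator_def)
    qed
    have "(\<lambda>(x, z). indicator {w. snd w - fst w \<in> R k} (x, z) * indicator B z :: real)
        \<in> borel_measurable (borel \<Otimes>\<^sub>M lborel)"
    proof -
      have m: "{w :: (real \<times> real) \<times> (real \<times> real). snd w - fst w \<in> R k} \<in> sets (borel \<Otimes>\<^sub>M lborel)"
        using borel_closed[OF cl] by (simp add: borel_prod[symmetric] cong: sets_pair_measure_cong)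
      have "(\<lambda>w. indicator {w. snd w - fst w \<in> R k} w * indicator B (snd w) :: real)
        \<in> borel_measurable (borel \<Otimes>\<^sub>M lborel)"
        using m B by measurable
      then show ?thesis by (simp add: case_prod_unfold)
    qed
    then have "(\<lambda>x. \<integral>z. indicator {w. snd w - fst w \<in> R k} (x, z) * (indicator B z :: real) \<partial>lborel)
        \<in> borel_measurable (borel :: (real \<times> real) measure)"
      by (rule lborel.borel_measurable_lebesgue_integral[of "\<lambda>x z. indicator {w. snd w - fst w \<in> R k} (x, z) * indicator B z"])
    then show ?thesis unfolding eq[abs_def] by measurable
  qed
  then have "(\<lambda>x. ereal \<bar>avg_op R k (indicator B) x\<bar>) \<in> borel_measurable borel" if "1 \<le> k" for k
    using that by (intro borel_measurable_ereal borel_measurable_abs) auto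
  then have "maximal_op R (indicator B) \<in> borel_measurable borel"
    unfolding maximal_op_def by (intro borel_measurable_SUP) auto
  then have "{x \<in> space borel. ereal l < maximal_op R (indicator B) x} \<in> sets borel"
    by (intro borel_measurable_less) auto
  then show ?thesis by simp
qed

section \<open>The Perron tree and its arms\<close>

lemma G_const_balanced:
  assumes b: "strict_mono b" and G: "G_const b < \<infinity>"
  obtains K where "K > 0"
    "\<And>m l. 1 \<le> l \<Longrightarrow> l \<le> m \<Longrightarrow>
        b (m + 2 * l) - b (m + l) \<le> K * (b (m + l) - b m) \<and>
        b (m + l) - b m \<le> K * (b (m + 2 * l) - b (m + l))"
proof -
  define q where "q m l = (b (m + 2 * l) - b (m + l)) / (b (m + l) - b m)
          + (b (m + l) - b m) / (b (m + 2 * l) - b (m + l))" for m l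
  have q: "ereal (q m l) \<le> G_const b" if "1 \<le> l" "l \<le> m" for m l
  proof -
    have "ereal (q m l) \<le> (SUP l\<in>{1..m}. ereal (q m l))" using that by (intro SUP_upper) auto
    also have "\<dots> \<le> (SUP m\<in>{1..}. SUP l\<in>{1..m}. ereal (q m l))"
      by (rule SUP_upper2[of m]) (use that in auto)
    finally show ?thesis by (simp add: G_const_def q_def)
  qed
  have "G_const b \<noteq> - \<infinity>" using q[of 1 1] by auto
  then obtain g where g: "G_const b = ereal g" using G by (cases "G_const b") auto
  define K where "K = max g 1"
  show ?thesis
  proof (rule that[of K])
    show "K > 0" by (simp add: K_def)
    fix m l :: nat assume ml: "1 \<le> l" "l \<le> m"
    define x y where "x = b (m + l) - b m" and "y = b (m + 2 * l) - b (m + l)"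
    have xy: "0 < x" "0 < y" using b ml by (simp_all add: x_def y_def strict_mono_less)
    have "y / x + x / y \<le> K" using q[OF ml] by (simp add: g q_def x_def y_def K_def)
    moreover have "0 < y / x" "0 < x / y" using xy by simp_all
    ultimately have "y / x \<le> K" "x / y \<le> K" by linarith+
    then have "y \<le> K * x" "x \<le> K * y" using xy by (simp_all add: pos_divide_le_eq)
    then show "b (m + 2 * l) - b (m + l) \<le> K * (b (m + l) - b m) \<and>
        b (m + l) - b m \<le> K * (b (m + 2 * l) - b (m + l))" by (simp add: x_def y_def)
  qed
qed

text \<open>With \<open>h = real n * \<eta>\<close> the bound is \<open>(1 + K) * D * h\<^sup>2 / n\<close>, where \<open>D\<close> is the increment of \<open>b\<close>
  over the block: smaller by a factor of order \<open>n\<close> than the total area of the triangles.\<close>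

lemma emeasure_perron_tree_le:
  fixes b :: "nat \<Rightarrow> real"
  assumes b: "strict_mono b" and \<eta>: "\<eta> > 0" and K: "K > 0" and n: "1 \<le> n"
    and bal: "\<And>m l. 1 \<le> l \<Longrightarrow> l \<le> m \<Longrightarrow>
        b (m + 2 * l) - b (m + l) \<le> K * (b (m + l) - b m) \<and>
        b (m + l) - b m \<le> K * (b (m + 2 * l) - b (m + l))"
    and m: "2 ^ n \<le> 2 * m"
  shows "emeasure lborel (\<Union>k\<in>{m<..m + 2 ^ n}.
      triangle_below (perron_shift b \<eta> n m k) (b (k - 1)) (b k) (real n * \<eta>))
    \<le> ennreal ((1 + K) * \<eta> * (b (m + 2 ^ n) - b m) * (real n * \<eta>))" (is "emeasure lborel ?B \<le> _")
proof -
  have "emeasure lborel ?B \<le> ennreal ((1 + K) * \<eta> * (b (m + 2 ^ n) - b m) * (0 - (- (real n * \<eta>))))"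
  proof (rule emeasure_le_by_slices)
    show "?B \<in> sets borel" by (auto intro!: borel_closed closed_UN closed_triangle_below)
    show "0 \<le> (1 + K) * \<eta> * (b (m + 2 ^ n) - b m)" using K \<eta> b by (simp add: strict_mono_less_eq)
    show "y \<in> {- (real n * \<eta>) .. 0}" if "(x, y) \<in> ?B" for x y
      using that by (auto simp: triangle_below_def)
    fix y assume y: "y \<in> {- (real n * \<eta>) .. 0}"
    \<comment> \<open>The level \<open>r\<close> whose groups are concentrated at depth \<open>t\<close>.\<close>
    define t where "t = - y"
    have t: "0 \<le> t" "t \<le> real n * \<eta>" using y by (auto simp: t_def)
    obtain r where r: "r \<le> n" "real r * \<eta> \<le> t" "t \<le> real (Suc r) * \<eta>"
    proof -
      define r where "r = nat \<lfloor>t / \<eta>\<rfloor>"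
      have q: "0 \<le> t / \<eta>" "t / \<eta> \<le> real n" using t \<eta> by (simp_all add: divide_le_eq)
      then have "real r \<le> t / \<eta>" "t / \<eta> \<le> real (Suc r)" by (simp_all add: r_def) linarith+
      moreover from this have "real r \<le> real n" using q by linarith
      ultimately have "real r * \<eta> \<le> t" "t \<le> real (Suc r) * \<eta>" "real r \<le> real n"
        using \<eta> by (simp_all only: pos_le_divide_eq pos_divide_le_eq)
      then show ?thesis using that by simp
    qed
    have "{x. (x, y) \<in> ?B} \<subseteq> tree_slice b \<eta> n m t"
      by (auto simp: triangle_below_def tree_slice_def t_def)
    then have "emeasure lborel {x. (x, y) \<in> ?B} \<le> emeasure lborel (tree_slice b \<eta> (r + (n - r)) m t)"
      using r(1) by (intro emeasure_mono) auto
    also have "\<dots> \<le> ennreal ((1 + K) * \<eta> * (b (m + 2 ^ (r + (n - r))) - b m))"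
      using bal r m by (intro emeasure_tree_slice_le[OF b \<eta> K, where M = m]) auto
    finally show "emeasure lborel {x. (x, y) \<in> ?B} \<le> ennreal ((1 + K) * \<eta> * (b (m + 2 ^ n) - b m))"
      using r(1) by simp
  qed (use \<eta> in simp)
  then show ?thesis by simp
qed

lemma emeasure_arm_above_ge:
  assumes "a \<le> c" and h: "0 < h"
  shows "ennreal (h\<^sup>2 / 64 * (c - a)) \<le> emeasure lborel (arm_above s a c h)"
proof -
  have "ennreal ((h / 8 * (c - a)) * (h / 4 - h / 8)) \<le> emeasure lborel (arm_above s a c h)"
  proof (rule emeasure_ge_by_slices)
    fix y assume y: "y \<in> {h / 8 .. h / 4}"
    have eq: "{x. (x, y) \<in> arm_above s a c h} = {s - y * c ..< s - y * a}"
      using y by (auto simp: arm_above_def)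
    have le: "h / 8 * (c - a) \<le> y * (c - a)" using y assms by (intro mult_right_mono) auto
    have "y * a \<le> y * c" using y assms by (intro mult_left_mono) auto
    then have "emeasure lborel {x. (x, y) \<in> arm_above s a c h} = ennreal (y * (c - a))"
      unfolding eq by (subst emeasure_lborel_Ico) (auto simp: right_diff_distrib)
    then show "ennreal (h / 8 * (c - a)) \<le> emeasure lborel {x. (x, y) \<in> arm_above s a c h}"
      using le by (simp add: ennreal_leI)
  qed (use assms borel_arm_above in auto)
  then show ?thesis by (simp add: power2_eq_square mult_ac)
qed

text \<open>The right edge of a later arm lies to the left of the left edge of an earlier one: its apex is
  not to the right of the earlier one, and \<open>b k \<le> b (k' - 1)\<close> for \<open>k < k'\<close>.\<close>

lemma emeasure_arms_ge:
  fixes b :: "nat \<Rightarrow> real"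
  assumes b: "mono b" and \<eta>: "\<eta> \<ge> 0" and h: "h > 0"
  shows "ennreal (h\<^sup>2 / 64 * (b (m + N) - b m)) \<le>
    emeasure lborel (\<Union>k\<in>{m<..m + N}. arm_above (perron_shift b \<eta> n m k) (b (k - 1)) (b k) h)"
proof -
  let ?V = "\<lambda>k. arm_above (perron_shift b \<eta> n m k) (b (k - 1)) (b k) h"
  have "?V k \<inter> ?V k' = {}" if "m < k" "k < k'" for k k'
  proof -
    have "b k \<le> b (k' - 1)" using that by (intro monoD[OF b]) simp
    moreover have "perron_shift b \<eta> n m k' \<le> perron_shift b \<eta> n m k"
      using that by (intro perron_shift_antimono[OF b \<eta>]) auto
    ultimately have sep: "perron_shift b \<eta> n m k' - y * b (k' - 1) \<le> perron_shift b \<eta> n m k - y * b k"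
      if "0 \<le> y" for y using that by (simp add: diff_mono mult_left_mono)
    show ?thesis
    proof (rule ccontr)
      assume "?V k \<inter> ?V k' \<noteq> {}"
      then obtain p where "p \<in> ?V k" "p \<in> ?V k'" by blast
      then show False using sep[of "snd p"] h by (simp add: arm_above_def)
    qed
  qed
  then have disj: "disjoint_family_on ?V {m<..m + N}"
    unfolding disjoint_family_on_def by (metis greaterThanAtMost_iff inf_commute linorder_neqE_nat)
  have "b (m + N) - b m = (\<Sum>k\<in>{m<..m + N}. b k - b (k - 1))"
  proof (induction N)
    case (Suc N)
    have "{m<..m + Suc N} = insert (Suc (m + N)) {m<..m + N}" by auto
    then show ?case using Suc by simp
  qed simp
  then have "ennreal (h\<^sup>2 / 64 * (b (m + N) - b m)) = ennreal (\<Sum>k\<in>{m<..m + N}. h\<^sup>2 / 64 * (b k - b (k - 1)))"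
    by (simp add: sum_distrib_left)
  also have "\<dots> = (\<Sum>k\<in>{m<..m + N}. ennreal (h\<^sup>2 / 64 * (b k - b (k - 1))))"
    by (intro sum_ennreal[symmetric]) (auto intro!: mult_nonneg_nonneg monoD[OF b])
  also have "\<dots> \<le> (\<Sum>k\<in>{m<..m + N}. emeasure lborel (?V k))"
    using h by (intro sum_mono emeasure_arm_above_ge) (auto intro!: monoD[OF b])
  also have "\<dots> = emeasure lborel (\<Union>k\<in>{m<..m + N}. ?V k)"
    using disj borel_arm_above by (intro sum_emeasure) auto
  finally show ?thesis .
qed

section \<open>Failure of the weak-type inequality\<close>

theorem theorem2p3:
  fixes b \<delta> :: "nat \<Rightarrow> real"
  assumes "strict_mono b" and "b 0 = 0"
    and "\<exists>c::real. c > 0 \<and> (\<forall>k\<ge>1. 1 + (b (k - 1))\<^sup>2 \<ge> c * (b k - b (k - 1))\<^sup>2)"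
    and "G_const b < \<infinity>"
    and "\<And>n. \<delta> n > 0"
    and "admissible b \<delta>"
  shows "Linfty_bad (rect_R b \<delta>)"
proof -
  note b = assms(1,2) and \<delta> = assms(5)
  have mono: "mono b" using b(1) by (rule strict_mono_mono)
  obtain K where K: "K > 0" and bal: "\<And>m l. 1 \<le> l \<Longrightarrow> l \<le> m \<Longrightarrow>
        b (m + 2 * l) - b (m + l) \<le> K * (b (m + l) - b m) \<and>
        b (m + l) - b m \<le> K * (b (m + 2 * l) - b (m + l))"
    using G_const_balanced[OF b(1) assms(4)] by blast
  have "real n \<le> 64 * C * (1 + K)" if n: "1 \<le> n" and C: "C > 0"
    and weak: "\<And>B. B \<in> sets borel \<Longrightarrow> emeasure lborel B < \<infinity> \<Longrightarrow>
        emeasure lborel {x. maximal_op (rect_R b \<delta>) (indicator B) x > ereal (1 / 80)}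
          \<le> ennreal C * emeasure lborel B" for n C
  proof -
    \<comment> \<open>Triangle \<open>k\<close> involves \<open>b (k - 1)\<close> and \<open>b k\<close>, so the block of indices is \<open>{m<..m + 2 ^ n}\<close>.\<close>
    define m :: nat where "m = 2 ^ n - 1"
    define h where "h = \<delta> n"
    define \<eta> where "\<eta> = h / real n"
    define D where "D = b (m + 2 ^ n) - b m"
    have h: "h > 0" "\<eta> > 0" "real n * \<eta> = h" using \<delta> n by (simp_all add: h_def \<eta>_def)
    have D: "D > 0" using b(1) by (simp add: D_def strict_mono_less)
    have "(2::nat) ^ 1 \<le> 2 ^ n" using n by (intro power_increasing) auto
    then have m: "2 ^ n \<le> 2 * m" by (simp add: m_def)
    let ?s = "perron_shift b \<eta> n m"
    define B where "B = (\<Union>k\<in>{m<..m + 2 ^ n}. triangle_below (?s k) (b (k - 1)) (b k) h)"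
    define V where "V = (\<Union>k\<in>{m<..m + 2 ^ n}. arm_above (?s k) (b (k - 1)) (b k) h)"
    have B: "B \<in> sets borel" unfolding B_def by (auto intro!: borel_closed closed_UN closed_triangle_below)
    have area: "emeasure lborel B \<le> ennreal ((1 + K) * \<eta> * D * h)"
      using emeasure_perron_tree_le[OF b(1) h(2) K n bal m] by (simp add: B_def D_def h(3))
    then have fin: "emeasure lborel B < \<infinity>" by (rule le_less_trans) simp
    have "V \<subseteq> {x. maximal_op (rect_R b \<delta>) (indicator B) x > ereal (1 / 80)}"
    proof
      fix p assume "p \<in> V"
      then obtain k where k: "k \<in> {m<..m + 2 ^ n}" and p: "p \<in> arm_above (?s k) (b (k - 1)) (b k) h"
        by (auto simp: V_def)
      have k1: "1 \<le> k" and idx: "dyadic_index k = n"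
        using k by (auto simp: m_def intro!: dyadic_index_eq)
      have ac: "0 \<le> b (k - 1)" "b (k - 1) < b k"
        using monoD[OF mono, of 0 "k - 1"] b k1 by (simp_all add: strict_mono_less)
      have "1 / 72 \<le> avg_op (rect_R b \<delta>) k (indicator B) p"
      proof (rule avg_op_ge_on_arm[OF _ ac h(1) B fin _ p])
        show "rect_R b \<delta> k = slab_rect (b (k - 1)) (b k) h"
          using rect_R_eq[where \<delta> = \<delta>, OF b k1 \<delta>] by (simp add: idx h_def)
        show "triangle_below (?s k) (b (k - 1)) (b k) h \<subseteq> B" using k by (auto simp: B_def)
      qed
      then have "ereal (1 / 80) < ereal \<bar>avg_op (rect_R b \<delta>) k (indicator B) p\<bar>" by simp
      also have "\<dots> \<le> maximal_op (rect_R b \<delta>) (indicator B) p"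
        unfolding maximal_op_def using k1 by (intro SUP_upper) auto
      finally show "p \<in> {x. maximal_op (rect_R b \<delta>) (indicator B) x > ereal (1 / 80)}" by simp
    qed
    moreover have "{x. maximal_op (rect_R b \<delta>) (indicator B) x > ereal (1 / 80)} \<in> sets borel"
      by (intro borel_maximal_op_superlevel B) (simp add: rect_R_eq[OF b _ \<delta>] closed_slab_rect)
    ultimately have "emeasure lborel V \<le>
        emeasure lborel {x. maximal_op (rect_R b \<delta>) (indicator B) x > ereal (1 / 80)}"
      by (intro emeasure_mono) auto
    also have "\<dots> \<le> ennreal C * emeasure lborel B" using weak B fin by blast
    also have "\<dots> \<le> ennreal C * ennreal ((1 + K) * \<eta> * D * h)" using area by (rule mult_left_mono) simp
    also have "\<dots> = ennreal (C * ((1 + K) * \<eta> * D * h))" using C K h D by (simp add: ennreal_mult)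
    finally have "emeasure lborel V \<le> ennreal (C * ((1 + K) * \<eta> * D * h))" .
    moreover have "ennreal (h\<^sup>2 / 64 * D) \<le> emeasure lborel V"
      unfolding V_def D_def using h by (intro emeasure_arms_ge mono) auto
    ultimately have "ennreal (h\<^sup>2 / 64 * D) \<le> ennreal (C * ((1 + K) * \<eta> * D * h))" by (rule order_trans[rotated])
    then have "h\<^sup>2 / 64 * D \<le> C * ((1 + K) * \<eta> * D * h)"
      using C K h D by (subst (asm) ennreal_le_iff) auto
    then have "(h * D * \<eta>) * real n \<le> (h * D * \<eta>) * (64 * C * (1 + K))"
      using h(3)[symmetric] by (simp add: power2_eq_square algebra_simps)
    then show "real n \<le> 64 * C * (1 + K)" using h D by simp
  qed
  note bound = this
  show ?thesis unfolding Linfty_bad_def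
  proof
    assume "Linfty_good (rect_R b \<delta>)"
    then obtain C :: real where C: "C > 0" and weak: "\<forall>B \<in> sets borel. emeasure lborel B < \<infinity> \<longrightarrow>
        emeasure lborel {x. maximal_op (rect_R b \<delta>) (indicator B) x > ereal (1 / 80)}
          \<le> ennreal C * emeasure lborel B"
      unfolding Linfty_good_def by (elim allE[of _ "1 / 80"]) auto
    obtain n where "64 * C * (1 + K) < real n" using reals_Archimedean2 by blast
    then have "64 * C * (1 + K) < real (Suc n)" by simp
    moreover have "real (Suc n) \<le> 64 * C * (1 + K)" using weak C by (intro bound) auto
    ultimately show False by simp
  qed
qed

end
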